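(* Let $\mathcal{P}$ be a multicriteria discrete minimization problem and $\alpha\ge1$. If there is an $\alpha$-approximation algorithm for $\min_{y\in\mathcal{Y}}\lambda^{T}y$ (for weight vectors $\lambda\in\mathbb{Q}^k_{\ge0}$), then there is a $k\alpha$-approximation algorithm for $\mathrm{RP}(\mathcal{P},\|\cdot\|_\infty)$.
   Context: A multicriteria discrete minimization problem $\mathcal{P}$ with a fixed number $k$ of objectives: an instance $I$ consists of a set $\mathcal{X}$ of feasible solutions and $c:\mathcal{X}\to\mathbb{Z}^k_{\ge0}$; $\mathcal{Y}=c(\mathcal{X})$. Standing assumption: one can compute $M\le2^{\pi(|I|)}$ ($\pi$ a fixed polynomial) with $\mathcal{Y}\subseteq[0,M]^k$. Vectors are compared componentwise. Ideal point: $y^{\mathrm{id}}_i=\min_{y\in\mathcal{Y}}y_i$; feasible reference point: $\bar y\in\mathbb{Z}^k_{\ge0}$ with $\bar y\le y^{\mathrm{id}}$. $\|y\|_\infty^\lambda=\max_i\lambda_i|y_i|$. $\mathrm{RP}(\mathcal{P},\|\cdot\|_\infty)$: given an instance, a feasible reference point $\bar y$ and $\lambda\in\mathbb{Q}^k_{\ge0}$, find $x\in\mathcal{X}$ minimizing $\|\bar y\|_\infty^\lambda+\|c(x)-\bar y\|_\infty^\lambda$; a $\beta$-approximation algorithm returns in polynomial time a feasible $x$ with value at most $\beta$ times the optimum. An $\alpha$-approximation for $\min_{y\in\mathcal{Y}}\lambda^Ty$ returns in polynomial time $y'\in\mathcal{Y}$ with $\lambda^Ty'\le\alpha\min_{y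\in\mathcal{Y}}\lambda^Ty$.
   Formalization: The α-approximation algorithm for the weighted sum is required to return a feasible solution x with c(x)=y', not only the vector y'; otherwise the claim fails (e.g. c constant 0 with feasible solutions that cannot be computed). *)

theory Defs
  imports
    Complex_Main
    "HOL-Computational_Algebra.Polynomial"
    "Jordan_Normal_Form.Matrix"
begin

section \<open>Polynomial time on deterministic multitape Turing machines\<close>

text \<open>
  States and tape symbols are initial segments of the naturals.  State \<open>0\<close> is initial and
  state \<open>tm_states T\<close> is the (only) halting state.  Symbol \<open>0\<close> is the blank, \<open>1\<close> and \<open>2\<close> are the
  bits, \<open>3\<close> is the separator, and further symbols are work symbols.  Tapes are infinite in both
  directions and are paired with the head position.
\<close>

datatype move = Move_Left | Stay | Move_Right

type_synonym tape = "(int \<Rightarrow> nat) \<times> int"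

record tm =
  tm_tapes :: nat
  tm_symbols :: nat
  tm_states :: nat
  tm_trans :: "nat \<Rightarrow> nat list \<Rightarrow> nat \<times> (nat \<times> move) list"

definition turing_machine :: "tm \<Rightarrow> bool" where
  "turing_machine T \<longleftrightarrow>
     1 \<le> tm_tapes T \<and> 4 \<le> tm_symbols T \<and>
     (\<forall>q < tm_states T. \<forall>s. length s = tm_tapes T \<and> set s \<subseteq> {..<tm_symbols T} \<longrightarrow>
        fst (tm_trans T q s) \<le> tm_states T \<and>
        length (snd (tm_trans T q s)) = tm_tapes T \<and>
        fst ` set (snd (tm_trans T q s)) \<subseteq> {..<tm_symbols T})"

fun shift :: "move \<Rightarrow> int" where
  "shift Move_Left = -1"
| "shift Stay = 0"
| "shift Move_Right = 1"

definition read_tape :: "tape \<Rightarrow> nat" where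
  "read_tape t = fst t (snd t)"

definition act_tape :: "nat \<times> move \<Rightarrow> tape \<Rightarrow> tape" where
  "act_tape a t = ((fst t)(snd t := fst a), snd t + shift (snd a))"

definition tm_step :: "tm \<Rightarrow> nat \<times> tape list \<Rightarrow> nat \<times> tape list" where
  "tm_step T C =
     (if fst C < tm_states T
      then let r = tm_trans T (fst C) (map read_tape (snd C))
           in (fst r, map2 act_tape (snd r) (snd C))
      else C)"

definition word_tape :: "nat list \<Rightarrow> tape" where
  "word_tape w = (\<lambda>i. if 0 \<le> i \<and> i < int (length w) then w ! nat i else 0, 0)"

definition tm_start :: "tm \<Rightarrow> nat list \<Rightarrow> nat \<times> tape list" where
  "tm_start T w = (0, word_tape w # replicate (tm_tapes T - 1) (word_tape []))"

text \<open>
  The input is on the first tape.  The output is read off the last tape, from cell \<open>0\<close> up to the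
  first blank.  Since halting configurations are fixed by \<open>tm_step\<close>, being halted after exactly
  \<open>t\<close> steps means having halted within \<open>t\<close> steps.
\<close>

definition tm_outputs_within :: "tm \<Rightarrow> nat list \<Rightarrow> nat list \<Rightarrow> nat \<Rightarrow> bool" where
  "tm_outputs_within T w v t \<longleftrightarrow>
     (let C = (tm_step T ^^ t) (tm_start T w); f = fst (last (snd C))
      in fst C = tm_states T \<and> 0 \<notin> set v \<and>
         (\<forall>i < length v. f (int i) = v ! i) \<and> f (int (length v)) = 0)"

text \<open>
  \<open>T\<close> solves in polynomial time the search problem with set of (valid) inputs \<open>D\<close> and relation
  \<open>R\<close> between inputs and admissible answers, inputs and answers being given by their codes.
\<close>

definition poly_time_solves ::
  "tm \<Rightarrow> 'a set \<Rightarrow> ('a \<Rightarrow> nat list) \<Rightarrow> ('b \<Rightarrow> nat list) \<Rightarrow> ('a \<Rightarrow> 'b \<Rightarrow> bool) \<Rightarrow> bool" where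
  "poly_time_solves T D code_in code_out R \<longleftrightarrow>
     turing_machine T \<and>
     (\<exists>p :: nat poly. \<forall>a\<in>D. \<exists>b. R a b \<and>
        tm_outputs_within T (code_in a) (code_out b) (poly p (length (code_in a))))"

section \<open>Codes\<close>

definition bits_word :: "bool list \<Rightarrow> nat list" where
  "bits_word bs = map (\<lambda>b. if b then 2 else 1) bs"

definition tuple_word :: "bool list list \<Rightarrow> nat list" where
  "tuple_word bss = concat (map (\<lambda>bs. bits_word bs @ [3]) bss)"

text \<open>Binary representation, least significant bit first.\<close>

fun nat_bits :: "nat \<Rightarrow> bool list" where
  "nat_bits n = (if n = 0 then [] else odd n # nat_bits (n div 2))"

declare nat_bits.simps [simp del]

definition nat_vec_bits :: "nat vec \<Rightarrow> bool list list" where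
  "nat_vec_bits v = map nat_bits (list_of_vec v)"

text \<open>Nonnegative rationals only: numerator and denominator in lowest terms.\<close>

definition rat_vec_bits :: "rat vec \<Rightarrow> bool list list" where
  "rat_vec_bits v =
     concat (map (\<lambda>r. [nat_bits (nat (fst (quotient_of r))), nat_bits (nat (snd (quotient_of r)))])
       (list_of_vec v))"

section \<open>Multicriteria discrete minimization problems\<close>

record ('i, 'x) mc_problem =
  objectives :: nat
  instances :: "'i set"
  feasible :: "'i \<Rightarrow> 'x set"
  cost :: "'i \<Rightarrow> 'x \<Rightarrow> nat vec"
  instance_bits :: "'i \<Rightarrow> bool list"
  solution_bits :: "'x \<Rightarrow> bool list"

definition outcomes :: "('i, 'x) mc_problem \<Rightarrow> 'i \<Rightarrow> nat vec set" where
  "outcomes P I = cost P I ` feasible P I"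

text \<open>
  The last conjunct is the standing assumption that some \<open>M \<le> 2 ^ \<pi>(|I|)\<close> with all outcomes
  in \<open>[0, M]\<^sup>k\<close> can be computed.  Feasible sets are nonempty, as the minima below presuppose.
\<close>

definition multicriteria_problem :: "('i, 'x) mc_problem \<Rightarrow> bool" where
  "multicriteria_problem P \<longleftrightarrow>
     1 \<le> objectives P \<and>
     inj_on (instance_bits P) (instances P) \<and>
     inj_on (solution_bits P) (\<Union>I\<in>instances P. feasible P I) \<and>
     (\<forall>I\<in>instances P. feasible P I \<noteq> {} \<and> outcomes P I \<subseteq> carrier_vec (objectives P)) \<and>
     (\<exists>(\<pi> :: nat poly) T.
        poly_time_solves T (instances P)
          (\<lambda>I. tuple_word [instance_bits P I]) (\<lambda>M. bits_word (nat_bits M))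
          (\<lambda>I M. M \<le> 2 ^ poly \<pi> (length (instance_bits P I)) \<and>
             (\<forall>y\<in>outcomes P I. \<forall>i < objectives P. y $ i \<le> M)))"

definition weights :: "('i, 'x) mc_problem \<Rightarrow> rat vec set" where
  "weights P = {l \<in> carrier_vec (objectives P). 0\<^sub>v (objectives P) \<le> l}"

definition ideal_point :: "('i, 'x) mc_problem \<Rightarrow> 'i \<Rightarrow> nat vec" where
  "ideal_point P I = vec (objectives P) (\<lambda>i. Min ((\<lambda>y. y $ i) ` outcomes P I))"

definition reference_points :: "('i, 'x) mc_problem \<Rightarrow> 'i \<Rightarrow> nat vec set" where
  "reference_points P I = {r \<in> carrier_vec (objectives P). r \<le> ideal_point P I}"

abbreviation rvec :: "nat vec \<Rightarrow> rat vec" where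
  "rvec \<equiv> map_vec rat_of_nat"

subsection \<open>Weighted sums\<close>

definition weighted_sum_opt :: "('i, 'x) mc_problem \<Rightarrow> 'i \<Rightarrow> rat vec \<Rightarrow> rat" where
  "weighted_sum_opt P I l = Min ((\<lambda>y. l \<bullet> rvec y) ` outcomes P I)"

text \<open>The returned outcome is \<open>cost P I x\<close>; it is given by a feasible solution \<open>x\<close> attaining it.\<close>

definition weighted_sum_approx_algorithm :: "('i, 'x) mc_problem \<Rightarrow> real \<Rightarrow> tm \<Rightarrow> bool" where
  "weighted_sum_approx_algorithm P \<alpha> T \<longleftrightarrow>
     poly_time_solves T
       (instances P \<times> weights P)
       (\<lambda>(I, l). tuple_word (instance_bits P I # rat_vec_bits l))
       (\<lambda>x. bits_word (solution_bits P x))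
       (\<lambda>(I, l) x. x \<in> feasible P I \<and>
          of_rat (l \<bullet> rvec (cost P I x)) \<le> \<alpha> * of_rat (weighted_sum_opt P I l))"

subsection \<open>The reference point problem for the weighted maximum norm\<close>

definition max_norm :: "rat vec \<Rightarrow> rat vec \<Rightarrow> rat" where
  "max_norm l y = Max ((\<lambda>i. l $ i * \<bar>y $ i\<bar>) ` {..<dim_vec y})"

definition rp_value :: "('i, 'x) mc_problem \<Rightarrow> 'i \<Rightarrow> nat vec \<Rightarrow> rat vec \<Rightarrow> 'x \<Rightarrow> rat" where
  "rp_value P I r l x = max_norm l (rvec r) + max_norm l (rvec (cost P I x) - rvec r)"

definition rp_opt :: "('i, 'x) mc_problem \<Rightarrow> 'i \<Rightarrow> nat vec \<Rightarrow> rat vec \<Rightarrow> rat" where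
  "rp_opt P I r l = Min (rp_value P I r l ` feasible P I)"

definition rp_approx_algorithm :: "('i, 'x) mc_problem \<Rightarrow> real \<Rightarrow> tm \<Rightarrow> bool" where
  "rp_approx_algorithm P \<beta> T \<longleftrightarrow>
     poly_time_solves T
       {(I, r, l). I \<in> instances P \<and> r \<in> reference_points P I \<and> l \<in> weights P}
       (\<lambda>(I, r, l). tuple_word (instance_bits P I # nat_vec_bits r @ rat_vec_bits l))
       (\<lambda>x. bits_word (solution_bits P x))
       (\<lambda>(I, r, l) x. x \<in> feasible P I \<and>
          of_rat (rp_value P I r l x) \<le> \<beta> * of_rat (rp_opt P I r l))"

end

theory Submission
  imports Defs
begin

text \<open>
  An \<open>\<alpha>\<close>-approximate solution of the weighted sum problem with the same weights \<open>\<lambda>\<close> is already good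
  enough.  Since \<open>0 \<le> r \<le> c(x)\<close>, the two maxima in the objective are attained at indices \<open>i\<close>, \<open>j\<close>
  with \<open>\<lambda>\<^sub>i r\<^sub>i + \<lambda>\<^sub>j (c(x)\<^sub>j - r\<^sub>j) \<le> \<lambda>\<^sup>T c(x)\<close>, and conversely
  \<open>\<lambda>\<^sup>T c(x) \<le> k max\<^sub>i \<lambda>\<^sub>i c(x)\<^sub>i\<close>, which is at most \<open>k\<close> times the objective.
  On the machine level, one extra tape suffices: the input is copied without the reference point
  to the first tape of the given machine, which is then simulated.
\<close>

section \<open>Removing components of the input\<close>

lemma funpow_chain:
  assumes "(f ^^ m) x = y" and "(f ^^ n) y = z"
  shows "(f ^^ (m + n)) x = z"
  using assms by (subst add.commute) (simp add: funpow_add)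

lemma tuple_word_simps [simp]:
  "tuple_word [] = []"
  "tuple_word (a # as) = bits_word a @ 3 # tuple_word as"
  "tuple_word (as @ bs) = tuple_word as @ tuple_word bs"
  by (simp_all add: tuple_word_def)

lemma separator_notin_bits_word [simp]: "3 \<notin> set (bits_word a)"
  by (auto simp: bits_word_def)

text \<open>Needed twice: codes contain no blank, so a blank reliably marks the end of a word, and
  their symbols lie below 4, hence in the alphabet of every machine.\<close>

lemma set_tuple_word: "set (tuple_word as) \<subseteq> {0<..<4}"
  by (induction as) (auto simp: bits_word_def)

text \<open>
  Tape \<open>0\<close> holds the input, the tapes from \<open>1\<close> on are those of \<open>T\<close>.  State \<open>0\<close> copies the first
  component, states \<open>1, \<dots>, k\<close> skip one component each, state \<open>k + 1\<close> copies the rest, state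
  \<open>k + 2\<close> rewinds tape \<open>1\<close>, and state \<open>k + 3 + q\<close> simulates state \<open>q\<close> of \<open>T\<close>.
\<close>

definition skip_trans :: "tm \<Rightarrow> nat \<Rightarrow> nat \<Rightarrow> nat list \<Rightarrow> nat \<times> (nat \<times> move) list" where
  "skip_trans T k q s =
     (let a = s ! 0; b = s ! 1; rest = map (\<lambda>c. (c, Stay)) (drop 2 s) in
      if q = 0 then (if a = 3 then 1 else 0, (a, Move_Right) # (a, Move_Right) # rest)
      else if q \<le> k then (if a = 3 then q + 1 else q, (a, Move_Right) # (b, Stay) # rest)
      else if q = k + 1 then
        (if a = 0 then (k + 2, (a, Stay) # (b, Move_Left) # rest)
         else (k + 1, (a, Move_Right) # (a, Move_Right) # rest))
      else if q = k + 2 then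
        (if b = 0 then (k + 3, (a, Stay) # (b, Move_Right) # rest)
         else (k + 2, (a, Stay) # (b, Move_Left) # rest))
      else let r = tm_trans T (q - (k + 3)) (tl s) in (k + 3 + fst r, (a, Stay) # snd r))"

definition skip_tm :: "tm \<Rightarrow> nat \<Rightarrow> tm" where
  "skip_tm T k = \<lparr>tm_tapes = Suc (tm_tapes T), tm_symbols = tm_symbols T,
     tm_states = k + 3 + tm_states T, tm_trans = skip_trans T k\<rparr>"

lemma skip_tm_simps [simp]:
  "tm_tapes (skip_tm T k) = Suc (tm_tapes T)"
  "tm_symbols (skip_tm T k) = tm_symbols T"
  "tm_states (skip_tm T k) = k + 3 + tm_states T"
  "tm_trans (skip_tm T k) = skip_trans T k"
  by (simp_all add: skip_tm_def)

text \<open>States below \<open>k + 3\<close> write back only symbols just read, so the alphabet of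
  \<open>T\<close> suffices; in the other states validity is inherited from
  \<open>T\<close>.\<close>

lemma turing_machine_skip_tm:
  assumes T: "turing_machine T"
  shows "turing_machine (skip_tm T k)"
proof -
  have *: "fst (skip_trans T k q s) \<le> k + 3 + tm_states T \<and>
      length (snd (skip_trans T k q s)) = Suc (tm_tapes T) \<and>
      fst ` set (snd (skip_trans T k q s)) \<subseteq> {..<tm_symbols T}"
    if q: "q < k + 3 + tm_states T" and len: "length s = Suc (tm_tapes T)"
      and s: "set s \<subseteq> {..<tm_symbols T}" for q s
  proof -
    obtain a b s' where s_eq: "s = a # b # s'"
      using len T by (cases s; cases "tl s") (auto simp: turing_machine_def)
    show ?thesis
    proof (cases "q < k + 3")
      case True
      then show ?thesis
        using len s by (auto simp: skip_trans_def s_eq Let_def)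
    next
      case False
      then have "q - (k + 3) < tm_states T"
        using q by linarith
      moreover have "length (tl s) = tm_tapes T" "set (tl s) \<subseteq> {..<tm_symbols T}"
        using len s by (auto simp: s_eq)
      ultimately have "fst (tm_trans T (q - (k + 3)) (tl s)) \<le> tm_states T"
        "length (snd (tm_trans T (q - (k + 3)) (tl s))) = tm_tapes T"
        "fst ` set (snd (tm_trans T (q - (k + 3)) (tl s))) \<subseteq> {..<tm_symbols T}"
        using T unfolding turing_machine_def by blast+
      then show ?thesis
        using False s by (auto simp: skip_trans_def s_eq Let_def)
    qed
  qed
  show ?thesis
    using T * by (auto simp: turing_machine_def)
qed

section \<open>Copying phase, with the remaining tapes of \<open>T\<close> still blank\<close>

definition skip_config :: "tm \<Rightarrow> nat list \<Rightarrow> nat \<Rightarrow> nat \<Rightarrow> nat list \<Rightarrow> int \<Rightarrow> nat \<times> tape list" where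
  "skip_config T w q i u h =
     (q, (fst (word_tape w), int i) # (fst (word_tape u), h) #
         replicate (tm_tapes T - 1) (word_tape []))"

lemma word_tape_nth: "i < length w \<Longrightarrow> fst (word_tape w) (int i) = w ! i"
  by (simp add: word_tape_def)

lemma word_tape_end: "fst (word_tape w) (int (length w)) = 0"
  by (simp add: word_tape_def)

lemma word_tape_snoc:
  "(fst (word_tape u))(int (length u) := a) = fst (word_tape (u @ [a]))"
  by (auto simp: word_tape_def fun_eq_iff nth_append)

lemma map2_stay:
  "map2 act_tape (map (\<lambda>c. (c, Stay)) (map read_tape ts)) ts = ts"
  by (induction ts) (auto simp: act_tape_def read_tape_def)

text \<open>The two copying cases keep raw tapes, since the written tape is recognised as a
  \<open>word_tape\<close> by \<open>word_tape_snoc\<close> only once \<open>h\<close> is known to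
  be the length of \<open>u\<close>.\<close>

lemma step_skip_config:
  assumes "q < k + 3"
  shows "tm_step (skip_tm T k) (skip_config T w q i u h) =
    (let a = fst (word_tape w) (int i); b = fst (word_tape u) h in
      if q = 0 then (if a = 3 then 1 else 0,
        (fst (word_tape w), int i + 1) # ((fst (word_tape u))(h := a), h + 1) #
          replicate (tm_tapes T - 1) (word_tape []))
      else if q \<le> k then skip_config T w (if a = 3 then q + 1 else q) (i + 1) u h
      else if q = k + 1 then
        (if a = 0 then skip_config T w (k + 2) i u (h - 1)
         else (k + 1, (fst (word_tape w), int i + 1) # ((fst (word_tape u))(h := a), h + 1) #
          replicate (tm_tapes T - 1) (word_tape [])))
      else (if b = 0 then skip_config T w (k + 3) i u (h + 1)
            else skip_config T w (k + 2) i u (h - 1)))"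
  using assms map2_stay[of "replicate (tm_tapes T - 1) (word_tape [])"]
  by (auto simp: tm_step_def skip_config_def skip_trans_def Let_def act_tape_def read_tape_def
      numeral_2_eq_2)

lemma run_copy_first:
  assumes "w = pre @ seg @ suf" and "3 \<notin> set seg"
  shows "(tm_step (skip_tm T k) ^^ length seg) (skip_config T w 0 (length pre) u (int (length u))) =
    skip_config T w 0 (length (pre @ seg)) (u @ seg) (int (length (u @ seg)))"
  using assms
proof (induction seg arbitrary: pre u)
  case (Cons a seg)
  have "tm_step (skip_tm T k) (skip_config T w 0 (length pre) u (int (length u))) =
      skip_config T w 0 (length (pre @ [a])) (u @ [a]) (int (length (u @ [a])))"
    using Cons.prems
    by (subst step_skip_config) (auto simp: Let_def word_tape_nth word_tape_snoc skip_config_def)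
  then show ?case
    using Cons.IH[of "pre @ [a]" "u @ [a]"] Cons.prems by (simp add: funpow_swap1)
qed simp

text \<open>Unlike state \<open>0\<close>, state \<open>k + 1\<close> copies separators too and is
  left only on a blank, which explains the different hypothesis on \<open>seg\<close>.\<close>

lemma run_copy_rest:
  assumes "w = pre @ seg @ suf" and "0 \<notin> set seg"
  shows "(tm_step (skip_tm T k) ^^ length seg)
      (skip_config T w (k + 1) (length pre) u (int (length u))) =
    skip_config T w (k + 1) (length (pre @ seg)) (u @ seg) (int (length (u @ seg)))"
  using assms
proof (induction seg arbitrary: pre u)
  case (Cons a seg)
  have "tm_step (skip_tm T k) (skip_config T w (k + 1) (length pre) u (int (length u))) =
      skip_config T w (k + 1) (length (pre @ [a])) (u @ [a]) (int (length (u @ [a])))"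
    using Cons.prems
    by (subst step_skip_config) (auto simp: Let_def word_tape_nth word_tape_snoc skip_config_def)
  then show ?case
    using Cons.IH[of "pre @ [a]" "u @ [a]"] Cons.prems by (simp add: funpow_swap1)
qed simp

lemma run_skip_word:
  assumes "w = pre @ seg @ suf" and "3 \<notin> set seg" and "0 < q" and "q \<le> k"
  shows "(tm_step (skip_tm T k) ^^ length seg) (skip_config T w q (length pre) u h) =
    skip_config T w q (length (pre @ seg)) u h"
  using assms
proof (induction seg arbitrary: pre)
  case (Cons a seg)
  have "tm_step (skip_tm T k) (skip_config T w q (length pre) u h) =
      skip_config T w q (length (pre @ [a])) u h"
    using Cons.prems by (simp add: step_skip_config Let_def word_tape_nth)
  then show ?case
    using Cons.IH[of "pre @ [a]"] Cons.prems by (simp add: funpow_swap1)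
qed simp

text \<open>The state is the counter of skipped components: it stays constant along the bits of a
  component and increases by one on its separator.\<close>

lemma run_skip_tuple:
  assumes "w = pre @ tuple_word bss @ suf" and "0 < q" and "q + length bss \<le> k + 1"
  shows "(tm_step (skip_tm T k) ^^ length (tuple_word bss)) (skip_config T w q (length pre) u h) =
    skip_config T w (q + length bss) (length (pre @ tuple_word bss)) u h"
  using assms
proof (induction bss arbitrary: pre q)
  case (Cons a bss)
  have "(tm_step (skip_tm T k) ^^ length (bits_word a)) (skip_config T w q (length pre) u h) =
      skip_config T w q (length (pre @ bits_word a)) u h"
    using Cons.prems by (intro run_skip_word) auto
  moreover have "(tm_step (skip_tm T k) ^^ 1) (skip_config T w q (length (pre @ bits_word a)) u h) =
      skip_config T w (q + 1) (length (pre @ bits_word a @ [3])) u h"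
    using Cons.prems word_tape_nth[of "length (pre @ bits_word a)" w]
    by (simp add: step_skip_config Let_def nth_append)
  moreover have "(tm_step (skip_tm T k) ^^ length (tuple_word bss))
      (skip_config T w (q + 1) (length (pre @ bits_word a @ [3])) u h) =
      skip_config T w (q + 1 + length bss) (length ((pre @ bits_word a @ [3]) @ tuple_word bss)) u h"
    using Cons.prems by (intro Cons.IH) auto
  ultimately have "(tm_step (skip_tm T k) ^^ (length (bits_word a) + 1 + length (tuple_word bss)))
      (skip_config T w q (length pre) u h) =
      skip_config T w (q + 1 + length bss) (length ((pre @ bits_word a @ [3]) @ tuple_word bss)) u h"
    by (blast intro: funpow_chain)
  then show ?case
    by simp
qed simp

text \<open>The head starts at \<open>n - 1\<close> because the step into state \<open>k + 2\<close>
  already moves left. After \<open>n\<close> moves it reads the blank in cell \<open>-1\<close>, and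
  one last step returns it to cell \<open>0\<close>; hence the integer head position and
  \<open>n + 1\<close> steps.\<close>

lemma run_rewind:
  assumes "0 \<notin> set u" and "n \<le> length u"
  shows "(tm_step (skip_tm T k) ^^ (n + 1)) (skip_config T w (k + 2) i u (int n - 1)) =
    skip_config T w (k + 3) i u 0"
  using assms(2)
proof (induction n)
  case 0
  have "fst (word_tape u) (- 1) = 0"
    by (simp add: word_tape_def)
  then show ?case
    by (simp add: step_skip_config Let_def)
next
  case (Suc n)
  have "fst (word_tape u) (int n) \<noteq> 0"
    using Suc.prems assms(1) by (auto simp: word_tape_nth in_set_conv_nth)
  then have "tm_step (skip_tm T k) (skip_config T w (k + 2) i u (int (Suc n) - 1)) =
      skip_config T w (k + 2) i u (int n - 1)"
    by (simp add: step_skip_config Let_def)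
  then show ?case
    using Suc by (simp add: funpow_swap1)
qed

text \<open>Each cell of \<open>w\<close> costs one step and each cell of \<open>u\<close> one
  rewinding step; the two additional steps are spent on the blank after \<open>w\<close> and the
  blank before \<open>u\<close>.\<close>

lemma run_skip_phase:
  fixes a bss css
  defines "w \<equiv> tuple_word (a # bss @ css)" and "u \<equiv> tuple_word (a # css)"
  assumes bss: "length bss = k"
  shows "(tm_step (skip_tm T k) ^^ (length w + length u + 2)) (skip_config T w 0 0 [] 0) =
    skip_config T w (k + 3) (length w) u 0"
proof -
  let ?f = "tm_step (skip_tm T k)"
  let ?a = "bits_word a"
  have u0: "0 \<notin> set u" "0 \<notin> set (tuple_word css)"
    using set_tuple_word[of "a # css"] set_tuple_word[of css] unfolding u_def by auto
  have "(?f ^^ length ?a) (skip_config T w 0 0 [] 0) =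
      skip_config T w 0 (length ?a) ?a (int (length ?a))"
    using run_copy_first[of w "[]" ?a "3 # tuple_word (bss @ css)" T k "[]"]
    by (simp add: w_def)
  moreover have "(?f ^^ 1) (skip_config T w 0 (length ?a) ?a (int (length ?a))) =
      skip_config T w 1 (length (?a @ [3])) (?a @ [3]) (int (length (?a @ [3])))"
    using word_tape_nth[of "length ?a" w] word_tape_snoc[of ?a 3]
    by (simp add: step_skip_config w_def) (simp add: skip_config_def)
  moreover have "(?f ^^ length (tuple_word bss))
      (skip_config T w 1 (length (?a @ [3])) (?a @ [3]) (int (length (?a @ [3])))) =
      skip_config T w (k + 1) (length (?a @ [3] @ tuple_word bss)) (?a @ [3])
        (int (length (?a @ [3])))"
    using run_skip_tuple[of w "?a @ [3]" bss "tuple_word css" 1 k T "?a @ [3]"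
        "int (length (?a @ [3]))"] bss
    by (simp add: w_def)
  moreover have "(?f ^^ length (tuple_word css))
      (skip_config T w (k + 1) (length (?a @ [3] @ tuple_word bss)) (?a @ [3])
        (int (length (?a @ [3])))) =
      skip_config T w (k + 1) (length w) u (int (length u))"
    using run_copy_rest[of w "?a @ [3] @ tuple_word bss" "tuple_word css" "[]" T k "?a @ [3]"] u0
    by (simp add: w_def u_def)
  moreover have "(?f ^^ 1) (skip_config T w (k + 1) (length w) u (int (length u))) =
      skip_config T w (k + 2) (length w) u (int (length u) - 1)"
    by (simp add: step_skip_config word_tape_end)
  moreover have "(?f ^^ (length u + 1)) (skip_config T w (k + 2) (length w) u (int (length u) - 1)) =
      skip_config T w (k + 3) (length w) u 0"
    using u0 by (intro run_rewind) auto
  ultimately have "(?f ^^ (length ?a + 1 + length (tuple_word bss) + length (tuple_word css) + 1 +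
      (length u + 1))) (skip_config T w 0 0 [] 0) = skip_config T w (k + 3) (length w) u 0"
    by (blast intro: funpow_chain)
  moreover have "length ?a + 1 + length (tuple_word bss) + length (tuple_word css) + 1 +
      (length u + 1) = length w + length u + 2"
    by (simp add: w_def)
  ultimately show ?thesis
    by (simp only:)
qed

section \<open>Simulation of the given machine\<close>

lemma step_simulate:
  "tm_step (skip_tm T k) (k + 3 + q, t0 # ts) =
    (k + 3 + fst (tm_step T (q, ts)), t0 # snd (tm_step T (q, ts)))"
  by (auto simp: tm_step_def skip_trans_def Let_def act_tape_def read_tape_def)

text \<open>Shifting states by \<open>k + 3\<close> preserves the halting test, so the two runs stay
  in step even after \<open>T\<close> has halted.\<close>

lemma run_simulate:
  "(tm_step (skip_tm T k) ^^ n) (k + 3 + q, t0 # ts) =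
    (k + 3 + fst ((tm_step T ^^ n) (q, ts)), t0 # snd ((tm_step T ^^ n) (q, ts)))"
proof (induction n)
  case (Suc n)
  then show ?case
    using step_simulate[of T k "fst ((tm_step T ^^ n) (q, ts))"] by simp
qed simp

text \<open>An invariant of runs. The alphabet bound is part of it because
  \<open>turing_machine\<close> constrains transitions only on symbols of the alphabet, and this is
  what keeps the number of tapes constant.\<close>

definition valid_config :: "tm \<Rightarrow> nat \<times> tape list \<Rightarrow> bool" where
  "valid_config T C \<longleftrightarrow> length (snd C) = tm_tapes T \<and>
     (\<forall>t\<in>set (snd C). \<forall>i. fst t i < tm_symbols T)"

lemma valid_config_step:
  assumes T: "turing_machine T" and C: "valid_config T C"
  shows "valid_config T (tm_step T C)"
proof (cases "fst C < tm_states T")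
  case True
  let ?r = "tm_trans T (fst C) (map read_tape (snd C))"
  have "length (map read_tape (snd C)) = tm_tapes T"
    "set (map read_tape (snd C)) \<subseteq> {..<tm_symbols T}"
    using C by (auto simp: valid_config_def read_tape_def)
  then have r: "length (snd ?r) = tm_tapes T" "fst ` set (snd ?r) \<subseteq> {..<tm_symbols T}"
    using T True unfolding turing_machine_def by blast+
  have "fst t i < tm_symbols T" if t: "t \<in> set (map2 act_tape (snd ?r) (snd C))" for t i
  proof -
    obtain x t' where "(x, t') \<in> set (zip (snd ?r) (snd C))" "t = act_tape x t'"
      using t by auto
    then have "fst x < tm_symbols T" "t' \<in> set (snd C)" "t = act_tape x t'"
      using r by (auto dest: set_zip_leftD set_zip_rightD)
    then show ?thesis
      using C by (auto simp: act_tape_def valid_config_def)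
  qed
  then show ?thesis
    using True r C by (auto simp: valid_config_def tm_step_def Let_def)
next
  case False
  then show ?thesis
    using C by (simp add: tm_step_def)
qed

lemma valid_config_run:
  assumes "turing_machine T" and "valid_config T C"
  shows "valid_config T ((tm_step T ^^ n) C)"
  using assms by (induction n) (auto intro: valid_config_step)

lemma valid_config_start:
  assumes "turing_machine T" and "set w \<subseteq> {..<tm_symbols T}"
  shows "valid_config T (tm_start T w)"
proof -
  have "w ! nat i < tm_symbols T" if "0 \<le> i" "i < int (length w)" for i
  proof -
    have "nat i < length w"
      using that by linarith
    then show ?thesis
      using assms(2) nth_mem by blast
  qed
  then show ?thesis
    using assms(1) by (auto simp: turing_machine_def valid_config_def tm_start_def word_tape_def)
qed

text \<open>A halted configuration is a fixed point of \<open>tm_step\<close>, so running longer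
  changes nothing. This allows time bounds to be rounded up.\<close>

lemma tm_outputs_within_mono:
  assumes "tm_outputs_within T w v t" and "t \<le> t'"
  shows "tm_outputs_within T w v t'"
proof -
  let ?C = "(tm_step T ^^ t) (tm_start T w)"
  have "tm_step T ?C = ?C"
    using assms(1) by (simp add: tm_outputs_within_def Let_def tm_step_def)
  then have "(tm_step T ^^ n) ?C = ?C" for n
    by (induction n) auto
  then have "(tm_step T ^^ t') (tm_start T w) = ?C"
    using assms(2) funpow_chain[of t "tm_step T" "tm_start T w" ?C "t' - t"] by simp
  then show ?thesis
    using assms(1) by (simp add: tm_outputs_within_def)
qed

lemma skip_tm_outputs_within:
  assumes T: "turing_machine T" and bss: "length bss = k"
    and out: "tm_outputs_within T (tuple_word (a # css)) v t"
  shows "tm_outputs_within (skip_tm T k) (tuple_word (a # bss @ css)) v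
    (2 * length (tuple_word (a # bss @ css)) + 2 + t)"
proof -
  let ?w = "tuple_word (a # bss @ css)" and ?u = "tuple_word (a # css)"
  let ?C = "(tm_step T ^^ t) (tm_start T ?u)"
  have tapes: "1 \<le> tm_tapes T" "4 \<le> tm_symbols T"
    using T by (auto simp: turing_machine_def)
  have "tm_start (skip_tm T k) ?w = skip_config T ?w 0 0 [] 0"
    using tapes by (cases "tm_tapes T") (auto simp: tm_start_def skip_config_def word_tape_def)
  then have "(tm_step (skip_tm T k) ^^ (length ?w + length ?u + 2)) (tm_start (skip_tm T k) ?w) =
      skip_config T ?w (k + 3) (length ?w) ?u 0"
    using run_skip_phase[OF bss, where T = T and a = a and css = css] by simp
  also have "skip_config T ?w (k + 3) (length ?w) ?u 0 =
      (k + 3 + fst (tm_start T ?u), (fst (word_tape ?w), int (length ?w)) # snd (tm_start T ?u))"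
    by (simp add: skip_config_def tm_start_def word_tape_def)
  finally have "(tm_step (skip_tm T k) ^^ (length ?w + length ?u + 2 + t))
      (tm_start (skip_tm T k) ?w) =
      (k + 3 + fst ?C, (fst (word_tape ?w), int (length ?w)) # snd ?C)"
    by (rule funpow_chain) (simp only: run_simulate prod.collapse)
  moreover have "set ?u \<subseteq> {..<tm_symbols T}"
    using set_tuple_word[of "a # css"] tapes by auto
  then have "valid_config T ?C"
    using T by (intro valid_config_run valid_config_start)
  \<comment> \<open>Ensures that \<open>last\<close> of the extended tape list is the last tape of
    \<open>T\<close>, where the output is read, and not the new input tape.\<close>
  then have "snd ?C \<noteq> []"
    using tapes by (auto simp: valid_config_def)
  ultimately have "tm_outputs_within (skip_tm T k) ?w v (length ?w + length ?u + 2 + t)"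
    using out by (simp add: tm_outputs_within_def Let_def)
  \<comment> \<open>Removing components only shortens the word, so the length of \<open>?u\<close>
    is at most that of \<open>?w\<close>.\<close>
  then show ?thesis
    by (rule tm_outputs_within_mono) simp
qed

text \<open>The coefficients are natural numbers. Used to pass from the shortened input of
  \<open>T\<close> to the full input.\<close>

lemma poly_nat_mono:
  fixes p :: "nat poly"
  assumes "m \<le> n"
  shows "poly p m \<le> poly p n"
  using assms by (induction p) (auto intro: add_mono mult_mono)

section \<open>Weighted sums and the weighted maximum norm\<close>

lemma max_norm_ge:
  assumes "i < dim_vec y"
  shows "l $ i * \<bar>y $ i\<bar> \<le> max_norm l y"
  using assms by (auto simp: max_norm_def intro: Max_ge)

lemma max_norm_attained:
  assumes "0 < dim_vec y"
  obtains i where "i < dim_vec y" and "max_norm l y = l $ i * \<bar>y $ i\<bar>"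
proof -
  have "max_norm l y \<in> (\<lambda>i. l $ i * \<bar>y $ i\<bar>) ` {..<dim_vec y}"
    unfolding max_norm_def using assms by (intro Max_in) auto
  then show ?thesis
    using that by auto
qed

lemma max_norms_le_weighted_sum:
  fixes l :: "rat vec" and r c :: "nat vec"
  assumes k: "0 < k" and r: "r \<in> carrier_vec k" and c: "c \<in> carrier_vec k"
    and l: "\<And>i. i < k \<Longrightarrow> 0 \<le> l $ i" and rc: "\<And>i. i < k \<Longrightarrow> r $ i \<le> c $ i"
  shows "max_norm l (rvec r) + max_norm l (rvec c - rvec r) \<le> l \<bullet> rvec c"
proof -
  let ?t = "\<lambda>i. l $ i * rat_of_nat (c $ i)"
  obtain i where i: "i < k" "max_norm l (rvec r) = l $ i * rat_of_nat (r $ i)"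
    using max_norm_attained[of "rvec r" l] k r by auto
  obtain j where j: "j < k"
    "max_norm l (rvec c - rvec r) = l $ j * (rat_of_nat (c $ j) - rat_of_nat (r $ j))"
    using max_norm_attained[of "rvec c - rvec r" l] k r c rc by auto
  have t: "l \<bullet> rvec c = sum ?t {..<k}"
    using c by (auto simp: scalar_prod_def atLeast0LessThan)
  have nonneg: "0 \<le> ?t m" if "m < k" for m
    using that l by simp
  have i_le: "l $ i * rat_of_nat (r $ i) \<le> ?t i"
    using i l rc by (intro mult_left_mono) auto
  have j_le: "l $ j * (rat_of_nat (c $ j) - rat_of_nat (r $ j)) \<le> ?t j"
    using j l by (intro mult_left_mono) auto
  \<comment> \<open>For distinct indices the two terms are bounded by different summands. For
    \<open>i = j\<close> separate bounds would count \<open>?t i\<close> twice, but the two terms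
    then add up to exactly \<open>?t i\<close>.\<close>
  have "max_norm l (rvec r) + max_norm l (rvec c - rvec r) \<le> sum ?t {i, j}"
    using i j i_le j_le by (cases "i = j") (auto simp: algebra_simps)
  also have "\<dots> \<le> sum ?t {..<k}"
    using i j nonneg by (intro sum_mono2) auto
  finally show ?thesis
    by (simp add: t)
qed

text \<open>Splitting \<open>c $ i\<close> into \<open>r $ i\<close> and the difference bounds each
  of the \<open>k\<close> summands by the sum of the two norms.\<close>

lemma weighted_sum_le_max_norms:
  fixes l :: "rat vec" and r c :: "nat vec"
  assumes r: "r \<in> carrier_vec k" and c: "c \<in> carrier_vec k"
    and rc: "\<And>i. i < k \<Longrightarrow> r $ i \<le> c $ i"
  shows "l \<bullet> rvec c \<le> of_nat k * (max_norm l (rvec r) + max_norm l (rvec c - rvec r))"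
proof -
  have "l $ i * rat_of_nat (c $ i) \<le> max_norm l (rvec r) + max_norm l (rvec c - rvec r)"
    if "i < k" for i
  proof -
    have "l $ i * rat_of_nat (r $ i) \<le> max_norm l (rvec r)"
      using max_norm_ge[of i "rvec r" l] that r by auto
    moreover have "l $ i * (rat_of_nat (c $ i) - rat_of_nat (r $ i)) \<le>
        max_norm l (rvec c - rvec r)"
      using max_norm_ge[of i "rvec c - rvec r" l] that r c rc by auto
    ultimately show ?thesis
      by (simp add: algebra_simps)
  qed
  then have "(\<Sum>i<k. l $ i * rat_of_nat (c $ i)) \<le>
      (\<Sum>i<k. max_norm l (rvec r) + max_norm l (rvec c - rvec r))"
    by (intro sum_mono) auto
  then show ?thesis
    using c by (auto simp: scalar_prod_def atLeast0LessThan)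
qed

text \<open>By the standing assumption the outcomes are natural vectors in a bounded box. Finiteness
  is what makes \<open>Min\<close> in the optima an attained minimum.\<close>

lemma finite_outcomes:
  assumes "multicriteria_problem P" and "I \<in> instances P"
  shows "finite (outcomes P I)"
proof -
  obtain M where M: "\<And>y i. y \<in> outcomes P I \<Longrightarrow> i < objectives P \<Longrightarrow> y $ i \<le> M"
    using assms unfolding multicriteria_problem_def poly_time_solves_def by meson
  have "outcomes P I \<subseteq> vec_of_list ` {xs. set xs \<subseteq> {..M} \<and> length xs = objectives P}"
  proof
    fix y assume y: "y \<in> outcomes P I"
    have "dim_vec y = objectives P"
      using assms y unfolding multicriteria_problem_def by (meson carrier_vecD subsetD)
    then have "set (list_of_vec y) \<subseteq> {..M}" "length (list_of_vec y) = objectives P"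
      using M[OF y] by (auto simp: in_set_conv_nth list_of_vec_index)
    then show "y \<in> vec_of_list ` {xs. set xs \<subseteq> {..M} \<and> length xs = objectives P}"
      by (intro image_eqI[of _ _ "list_of_vec y"]) (auto simp: vec_list)
  qed
  then show ?thesis
    by (rule finite_subset) (simp add: finite_lists_length_eq)
qed

section \<open>Transfer of the approximation guarantee\<close>

lemma weighted_sum_approx_imp_rp_approx:
  assumes P: "multicriteria_problem P" and "1 \<le> \<alpha>"
    and I: "I \<in> instances P" and r: "r \<in> reference_points P I" and l: "l \<in> weights P"
    and x: "x \<in> feasible P I"
    and approx: "of_rat (l \<bullet> rvec (cost P I x)) \<le> \<alpha> * of_rat (weighted_sum_opt P I l)"
  shows "of_rat (rp_value P I r l x) \<le>
    real (objectives P) * \<alpha> * of_rat (rp_opt P I r l)"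
proof -
  let ?k = "objectives P"
  note fin = finite_outcomes[OF P I]
  have k: "0 < ?k" and "outcomes P I \<subseteq> carrier_vec ?k"
    using P I unfolding multicriteria_problem_def by (simp_all only: less_eq_Suc_le One_nat_def)
  then have c: "cost P I x \<in> carrier_vec ?k" if "x \<in> feasible P I" for x
    using that by (auto simp: outcomes_def)
  have r_dim: "r \<in> carrier_vec ?k"
    using r by (simp add: reference_points_def)
  have l_nonneg: "0 \<le> l $ i" if "i < ?k" for i
  proof -
    have "dim_vec l = ?k" "0\<^sub>v ?k \<le> l"
      using l by (simp_all add: weights_def)
    then have "0\<^sub>v ?k $ i \<le> l $ i"
      using that unfolding less_eq_vec_def by metis
    then show ?thesis
      using that by simp
  qed
  have rc: "r $ i \<le> cost P I x $ i" if "x \<in> feasible P I" "i < ?k" for x i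
  proof -
    have "r $ i \<le> Min ((\<lambda>y. y $ i) ` outcomes P I)"
      using r that by (simp add: reference_points_def ideal_point_def less_eq_vec_def)
    also have "\<dots> \<le> cost P I x $ i"
      using fin that by (intro Min_le) (auto simp: outcomes_def)
    finally show ?thesis .
  qed
  \<comment> \<open>The feasible set itself may be infinite, but the objective depends on a solution
    only through its outcome.\<close>
  have "rp_value P I r l ` feasible P I =
      (\<lambda>y. max_norm l (rvec r) + max_norm l (rvec y - rvec r)) ` outcomes P I"
    by (auto simp: rp_value_def outcomes_def)
  then have "finite (rp_value P I r l ` feasible P I)"
    using fin by simp
  then have "rp_opt P I r l \<in> rp_value P I r l ` feasible P I"
    unfolding rp_opt_def using x by (intro Min_in) auto
  then obtain z where z: "z \<in> feasible P I" "rp_opt P I r l = rp_value P I r l z"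
    by auto
  have "weighted_sum_opt P I l \<le> l \<bullet> rvec (cost P I z)"
    unfolding weighted_sum_opt_def using fin z by (intro Min_le) (auto simp: outcomes_def)
  also have "\<dots> \<le> of_nat ?k * rp_opt P I r l"
    using weighted_sum_le_max_norms[OF r_dim c rc] z by (simp add: rp_value_def)
  finally have opt: "real_of_rat (weighted_sum_opt P I l) \<le> real ?k * of_rat (rp_opt P I r l)"
    by (metis of_rat_less_eq of_rat_mult of_rat_of_nat_eq)
  have "rp_value P I r l x \<le> l \<bullet> rvec (cost P I x)"
    using max_norms_le_weighted_sum[OF k r_dim c l_nonneg rc] x by (simp add: rp_value_def)
  then have "real_of_rat (rp_value P I r l x) \<le> \<alpha> * of_rat (weighted_sum_opt P I l)"
    using approx by (meson of_rat_less_eq order_trans)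
  also have "\<dots> \<le> \<alpha> * (real ?k * of_rat (rp_opt P I r l))"
    using opt \<open>1 \<le> \<alpha>\<close> by (intro mult_left_mono) auto
  finally show ?thesis
    by (simp add: ac_simps)
qed

section \<open>Assembly of the algorithm and its polynomial time bound\<close>

theorem theorem10:
  fixes P :: "('i, 'x) mc_problem" and \<alpha> :: real
  assumes "multicriteria_problem P"
    and "1 \<le> \<alpha>"
    and "\<exists>T. weighted_sum_approx_algorithm P \<alpha> T"
  shows "\<exists>T. rp_approx_algorithm P (real (objectives P) * \<alpha>) T"
proof -
  obtain T p where T: "turing_machine T"
    and solves: "\<And>I l. I \<in> instances P \<Longrightarrow> l \<in> weights P \<Longrightarrow> \<exists>x. x \<in> feasible P I \<and>
        of_rat (l \<bullet> rvec (cost P I x)) \<le> \<alpha> * of_rat (weighted_sum_opt P I l) \<and>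
        tm_outputs_within T (tuple_word (instance_bits P I # rat_vec_bits l))
          (bits_word (solution_bits P x))
          (poly p (length (tuple_word (instance_bits P I # rat_vec_bits l))))"
    using assms(3) unfolding weighted_sum_approx_algorithm_def poly_time_solves_def by fast
  \<comment> \<open>The summand \<open>[:2, 2:]\<close> is the overhead \<open>2 * n + 2\<close> of
    copying and rewinding.\<close>
  let ?T = "skip_tm T (objectives P)" and ?p = "[:2, 2:] + p"
  have "\<exists>x. (x \<in> feasible P I \<and>
        of_rat (rp_value P I r l x) \<le> real (objectives P) * \<alpha> * of_rat (rp_opt P I r l)) \<and>
      tm_outputs_within ?T (tuple_word (instance_bits P I # nat_vec_bits r @ rat_vec_bits l))
        (bits_word (solution_bits P x))
        (poly ?p (length (tuple_word (instance_bits P I # nat_vec_bits r @ rat_vec_bits l))))"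
    if I: "I \<in> instances P" and r: "r \<in> reference_points P I" and l: "l \<in> weights P" for I r l
  proof -
    let ?u = "tuple_word (instance_bits P I # rat_vec_bits l)"
    let ?w = "tuple_word (instance_bits P I # nat_vec_bits r @ rat_vec_bits l)"
    obtain x where x: "x \<in> feasible P I"
      "of_rat (l \<bullet> rvec (cost P I x)) \<le> \<alpha> * of_rat (weighted_sum_opt P I l)"
      and out: "tm_outputs_within T ?u (bits_word (solution_bits P x)) (poly p (length ?u))"
      using solves[OF I l] by blast
    \<comment> \<open>The number of components to skip is fixed by the problem, so one machine
      serves all instances.\<close>
    have "length (nat_vec_bits r) = objectives P"
      using r by (simp add: nat_vec_bits_def reference_points_def)
    from skip_tm_outputs_within[OF T this out]
    have "tm_outputs_within ?T ?w (bits_word (solution_bits P x))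
        (2 * length ?w + 2 + poly p (length ?u))" .
    moreover have "poly p (length ?u) \<le> poly p (length ?w)"
      by (intro poly_nat_mono) simp
    then have "2 * length ?w + 2 + poly p (length ?u) \<le> poly ?p (length ?w)"
      by simp
    ultimately have "tm_outputs_within ?T ?w (bits_word (solution_bits P x)) (poly ?p (length ?w))"
      by (rule tm_outputs_within_mono)
    then show ?thesis
      using weighted_sum_approx_imp_rp_approx[OF assms(1,2) I r l x] x(1) by blast
  qed
  then have "rp_approx_algorithm P (real (objectives P) * \<alpha>) ?T"
    unfolding rp_approx_algorithm_def poly_time_solves_def
    using turing_machine_skip_tm[OF T] by (intro conjI exI[of _ ?p]) auto
  then show ?thesis
    by blast
qed

end
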